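(* Let $a\in\mathbb{R}_{+}$ and $\nu,\alpha,\beta,\gamma,\delta,\eta,\lambda_1,\lambda_2,\lambda_3\in\mathbb{C}$ with $\Re(\nu),\Re(\alpha),\Re(\beta),\Re(\gamma),\Re(\delta)>0$. Then for $y>a$ the following relations hold: $$\left(I^{\nu}_{a^+}\left[(r-a)^{\delta-1}E_{\alpha,\beta,\gamma,\delta}^{\eta}(\lambda_{1}(r-a)^{\alpha},\lambda_{2}(r-a)^{\beta},\lambda_{3}(r-a)^{\gamma})\right]\right)(y)=(y-a)^{\delta+\nu-1}E_{\alpha,\beta,\gamma,\delta+\nu}^{\eta}(\lambda_{1}(y-a)^{\alpha},\lambda_{2}(y-a)^{\beta},\lambda_{3}(y-a)^{\gamma}),$$ and $$\left(D^{\nu}_{a^+}\left[(r-a)^{\delta-1}E_{\alpha,\beta,\gamma,\delta}^{\eta}(\lambda_{1}(r-a)^{\alpha},\lambda_{2}(r-a)^{\beta},\lambda_{3}(r-a)^{\gamma})\right]\right)(y)=(y-a)^{\delta-\nu-1}E_{\alpha,\beta,\gamma,\delta-\nu}^{\eta}(\lambda_{1}(y-a)^{\alpha},\lambda_{2}(y-a)^{\beta},\lambda_{3}(y-a)^{\gamma}),$$ where $r>a$ denotes the variable of the function to which the operators are applied.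
   Context: The trivariate Mittag-Leffler function is $$E_{\alpha,\beta,\gamma,\delta}^{\eta}(u,v,w)=\sum_{l=0}^{\infty}\sum_{p=0}^{\infty}\sum_{k=0}^{\infty}\frac{(\eta)_{l+p+k}}{\Gamma(l\alpha+p\beta+k\gamma+\delta)}\frac{u^l v^p w^k}{l!\,p!\,k!},$$ for $\alpha,\beta,\gamma,\delta,\eta\in\mathbb{C}$ with $\Re(\alpha),\Re(\beta),\Re(\gamma)>0$ and $u,v,w\in\mathbb{C}$. Here $(\eta)_0=1$, $(\eta)_n=\eta(\eta+1)\cdots(\eta+n-1)$ for $n\ge 1$, and $1/\Gamma$ is the entire reciprocal Gamma function (zero at the poles of $\Gamma$). For $\Re(\nu)>0$ the Riemann–Liouville fractional integral is $(I^{\nu}_{a^+}g)(y)=\frac{1}{\Gamma(\nu)}\int_a^y (y-s)^{\nu-1}g(s)\,ds$, $y>a$, and the Riemann–Liouville fractional derivative is $(D^{\nu}_{a^+}g)(y)=\frac{d^n}{dy^n}(I^{n-\nu}_{a^+}g)(y)$ with $n=\lfloor\Re(\nu)\rfloor+1$. Powers of positive reals are principal. *)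

theory Defs
  imports "HOL-Analysis.Analysis"
begin

text \<open>
  The factor 1/Gamma is the entire function \<^const>\<open>rGamma\<close>, so \<open>\<delta>\<close> is unrestricted.
\<close>

definition mittag_leffler3 ::
  "complex \<Rightarrow> complex \<Rightarrow> complex \<Rightarrow> complex \<Rightarrow> complex \<Rightarrow> complex \<Rightarrow> complex \<Rightarrow> complex \<Rightarrow> complex"
  where
  "mittag_leffler3 \<alpha> \<beta> \<gamma> \<delta> \<eta> u v w =
     (\<Sum>l. \<Sum>p. \<Sum>k.
        pochhammer \<eta> (l + p + k) * rGamma (of_nat l * \<alpha> + of_nat p * \<beta> + of_nat k * \<gamma> + \<delta>)
          * (u ^ l * v ^ p * w ^ k / (fact l * fact p * fact k)))"

definition ml3_kernel ::
  "real \<Rightarrow> complex \<Rightarrow> complex \<Rightarrow> complex \<Rightarrow> complex \<Rightarrow> complex \<Rightarrow>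
     complex \<Rightarrow> complex \<Rightarrow> complex \<Rightarrow> real \<Rightarrow> complex"
  where
  "ml3_kernel a \<alpha> \<beta> \<gamma> \<delta> \<eta> l1 l2 l3 r =
     complex_of_real (r - a) powr (\<delta> - 1) *
     mittag_leffler3 \<alpha> \<beta> \<gamma> \<delta> \<eta>
       (l1 * complex_of_real (r - a) powr \<alpha>)
       (l2 * complex_of_real (r - a) powr \<beta>)
       (l3 * complex_of_real (r - a) powr \<gamma>)"

definition RL_integrable :: "real \<Rightarrow> complex \<Rightarrow> (real \<Rightarrow> complex) \<Rightarrow> real \<Rightarrow> bool" where
  "RL_integrable a \<nu> g y \<longleftrightarrow>
     set_integrable lborel {a<..<y} (\<lambda>s. complex_of_real (y - s) powr (\<nu> - 1) * g s)"

definition RL_integral :: "real \<Rightarrow> complex \<Rightarrow> (real \<Rightarrow> complex) \<Rightarrow> real \<Rightarrow> complex" where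
  "RL_integral a \<nu> g y =
     1 / Gamma \<nu> * (LBINT s:{a<..<y}. complex_of_real (y - s) powr (\<nu> - 1) * g s)"

definition nth_derivative :: "nat \<Rightarrow> (real \<Rightarrow> complex) \<Rightarrow> real \<Rightarrow> complex" where
  "nth_derivative n f = ((\<lambda>h t. vector_derivative h (at t)) ^^ n) f"

definition RL_order :: "complex \<Rightarrow> nat" where
  "RL_order \<nu> = nat (\<lfloor>Re \<nu>\<rfloor> + 1)"

definition RL_derivative :: "real \<Rightarrow> complex \<Rightarrow> (real \<Rightarrow> complex) \<Rightarrow> real \<Rightarrow> complex" where
  "RL_derivative a \<nu> g =
     nth_derivative (RL_order \<nu>) (RL_integral a (of_nat (RL_order \<nu>) - \<nu>) g)"

text \<open>
  Existence of the fractional derivative at every point above \<open>a\<close>: \<^const>\<open>RL_derivative\<close> alone is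
  a total function that also has a value where an integral or a derivative fails to exist.
\<close>

definition RL_differentiable :: "real \<Rightarrow> complex \<Rightarrow> (real \<Rightarrow> complex) \<Rightarrow> bool" where
  "RL_differentiable a \<nu> g \<longleftrightarrow>
     (\<forall>t>a. RL_integrable a (of_nat (RL_order \<nu>) - \<nu>) g t) \<and>
     (\<forall>m<RL_order \<nu>. \<forall>t>a.
        nth_derivative m (RL_integral a (of_nat (RL_order \<nu>) - \<nu>) g) differentiable (at t))"

end

theory Submission
  imports Defs
begin

text \<open>
  Enumerating the triples \<open>(l, p, k)\<close> turns \<open>x\<^sup>\<delta>\<^sup>-\<^sup>1 E\<^sub>\<delta>(\<dots>)\<close> into a single series
  \<open>G\<^sub>\<delta>(x) = (\<Sum>j. c\<^sub>j / \<Gamma>(s\<^sub>j + \<delta>) x powr (s\<^sub>j + \<delta> - 1))\<close>. Integrating termwise with the complex Beta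
  integral gives \<open>I\<^sup>\<nu> G\<^sub>\<delta> = G\<^sub>\<delta>\<^sub>+\<^sub>\<nu>\<close>, and \<open>z / \<Gamma>(z + 1) = 1 / \<Gamma>(z)\<close> gives \<open>G\<^sub>\<delta>' = G\<^sub>\<delta>\<^sub>-\<^sub>1\<close>; together
  they yield the fractional derivative.

  Both interchanges rest on a bound for \<open>1 / \<Gamma>(l\<alpha> + p\<beta> + k\<gamma> + \<delta>)\<close> at complex arguments. By
  \<open>\<bar>B(z, w)\<bar> \<le> B(Re z, Re w)\<close> the ratio \<open>q(z) = \<Gamma>(Re z) / \<bar>\<Gamma>(z)\<bar>\<close> is submultiplicative,
  \<open>q(z + w) \<le> q(z) q(w)\<close>, so it grows at most geometrically in \<open>(l, p, k)\<close>, while the real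
  Gamma function grows faster than any geometric sequence.
\<close>

subsection \<open>The complex Beta integral\<close>

lemma borel_measurable_powr_mult_powr:
  fixes a b :: complex and u :: real
  shows "(\<lambda>t. indicator {0<..<u} t *\<^sub>R
           (complex_of_real t powr a * complex_of_real (u - t) powr b)) \<in> borel_measurable borel"
  by (intro borel_measurable_continuous_on_indicator) (auto intro!: continuous_intros)

text \<open>The norm of the integrand is the real Beta integrand with parameters \<open>Re a\<close>
  and \<open>Re b\<close>, which serves as the dominating function.\<close>

lemma Beta_integrand_integrable:
  assumes "Re a > 0" "Re b > 0"
  shows "integrable lborel (\<lambda>t. indicator {0<..<1} t *\<^sub>R
           (complex_of_real t powr (a - 1) * complex_of_real (1 - t) powr (b - 1)))"
proof (rule Bochner_Integration.integrable_bound)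
  show "integrable lborel (\<lambda>t. indicator {0..1} t *\<^sub>R
          (t powr (Re a - 1) * (1 - t) powr (Re b - 1)))"
    using integrable_Beta[OF assms] by (simp add: set_integrable_def)
qed (use borel_measurable_powr_mult_powr[of 1] in
      \<open>auto simp: norm_mult norm_powr_real_powr indicator_def intro!: AE_I2\<close>)

text \<open>The substitution t = u x scales out all dependence on \<open>u\<close>. The constant
  \<open>B\<close> stays an unevaluated integral: identifying it with \<open>Beta a b\<close> is
  done later, by an argument that uses this scaling.\<close>

lemma has_bochner_integral_powr_mult_powr_aux:
  fixes a b :: complex and u :: real
  assumes "Re a > 0" "Re b > 0" "u > 0"
  defines "B \<equiv> (LINT x|lborel. indicator {0<..<1} x *\<^sub>R
           (complex_of_real x powr (a - 1) * complex_of_real (1 - x) powr (b - 1)))"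
  shows "has_bochner_integral lborel (\<lambda>t. indicator {0<..<u} t *\<^sub>R
           (complex_of_real t powr (a - 1) * complex_of_real (u - t) powr (b - 1)))
           (complex_of_real u powr (a + b - 1) * B)"
proof -
  define f where "f = (\<lambda>t. indicator {0<..<u} t *\<^sub>R
           (complex_of_real t powr (a - 1) * complex_of_real (u - t) powr (b - 1)))"
  define g where "g = (\<lambda>x. indicator {0<..<1} x *\<^sub>R
           (complex_of_real x powr (a - 1) * complex_of_real (1 - x) powr (b - 1)))"
  \<comment> \<open>The two powers contribute exponents a - 1 and b - 1, hence a + b - 2; the
    Jacobian \<open>u\<close> supplies the missing 1.\<close>
  have fg: "f (0 + u * x) = complex_of_real u powr (a + b - 2) * g x" for x
  proof (cases "0 < x \<and> x < 1")
    case True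
    have "u - u * x = u * (1 - x)"
      by (simp add: algebra_simps)
    moreover have "u * x < u" using True assms(3) by simp
    ultimately show ?thesis
      using True assms(3) unfolding f_def g_def
      by (simp add: powr_times_real powr_add[symmetric] del: of_real_diff)
  next
    case False
    then show ?thesis
      using assms(3) by (auto simp: f_def g_def indicator_def zero_less_mult_iff)
  qed
  have g: "integrable lborel g"
    using Beta_integrand_integrable[OF assms(1,2)] by (simp add: g_def)
  then have "integrable lborel (\<lambda>x. f (0 + u * x))"
    unfolding fg by simp
  then have "integrable lborel f"
    using lborel_integrable_real_affine_iff[of u f 0] assms(3) by simp
  moreover have "integral\<^sup>L lborel f = u *\<^sub>R (complex_of_real u powr (a + b - 2) * B)"
    using lborel_integral_real_affine[of u f 0] assms(3)
    unfolding fg B_def g_def[symmetric] by simp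
  moreover have "u *\<^sub>R (complex_of_real u powr (a + b - 2) * B) = complex_of_real u powr (a + b - 1) * B"
    using assms(3) by (simp add: scaleR_conv_of_real powr_diff powr_add power2_eq_square)
  ultimately show ?thesis
    by (simp add: has_bochner_integral_iff f_def)
qed

section \<open>Evaluation of the Beta integral through Euler's Gamma integral\<close>

lemma Gamma_complex_nonzero: "Re z > 0 \<Longrightarrow> Gamma z \<noteq> 0"
  by (auto simp: Gamma_eq_zero_iff elim!: nonpos_Ints_cases)

text \<open>Euler's integral is moved from \<open>lebesgue\<close> to \<open>lborel\<close>, where
  Fubini on the product measure is applied below. Borel measurability of the integrand makes the
  passage from the completion harmless.\<close>

lemma Gamma_has_bochner_integral:
  assumes "Re z > 0"
  shows "has_bochner_integral lborel
           (\<lambda>t. indicator {0<..} t *\<^sub>R (complex_of_real t powr (z - 1) / of_real (exp t))) (Gamma z)"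
proof -
  let ?f = "\<lambda>t. complex_of_real t powr (z - 1) / of_real (exp t)"
  have m: "(\<lambda>t. indicator {0<..} t *\<^sub>R ?f t) \<in> borel_measurable borel"
    by (intro borel_measurable_continuous_on_indicator) (auto intro!: continuous_intros)
  have "integrable lborel (\<lambda>t. indicator {0<..} t *\<^sub>R ?f t)"
    using absolutely_integrable_Gamma_integral'[OF assms] m
    by (simp add: set_integrable_def integrable_completion)
  moreover have "integral\<^sup>L lborel (\<lambda>t. indicator {0<..} t *\<^sub>R ?f t) = Gamma z"
  proof -
    have "(LINT t|lebesgue. indicator {0<..} t *\<^sub>R ?f t) = integral {0<..} ?f"
      using set_lebesgue_integral_eq_integral(2)[OF absolutely_integrable_Gamma_integral'[OF assms]]
      by (simp add: set_lebesgue_integral_def)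
    then show ?thesis
      using Gamma_integral_complex'[OF assms] m
      by (simp add: integral_completion has_integral_iff)
  qed
  ultimately show ?thesis
    by (simp add: has_bochner_integral_iff)
qed

text \<open>The classical convolution argument: Gamma a * Gamma b is the integral of the convolution
  of the two Gamma integrands. Computing that convolution pointwise gives the integrand for a + b
  times the constant \<open>B\<close>, so B = Gamma a * Gamma b / Gamma (a + b).\<close>

theorem has_bochner_integral_Beta:
  assumes a: "Re a > 0" and b: "Re b > 0"
  shows "has_bochner_integral lborel (\<lambda>t. indicator {0<..<1} t *\<^sub>R
           (complex_of_real t powr (a - 1) * complex_of_real (1 - t) powr (b - 1))) (Beta a b)"
proof -
  define B where "B = (LINT x|lborel. indicator {0<..<1} x *\<^sub>R
           (complex_of_real x powr (a - 1) * complex_of_real (1 - x) powr (b - 1)))"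
  define \<phi> where "\<phi> = (\<lambda>z t. indicator {0<..} t *\<^sub>R
           (complex_of_real t powr (z - 1) / of_real (exp t)))"
  have \<phi>: "integrable lborel (\<phi> z)" "integral\<^sup>L lborel (\<phi> z) = Gamma z" if "Re z > 0" for z
    using Gamma_has_bochner_integral[OF that] by (simp_all add: \<phi>_def has_bochner_integral_iff)
  have [measurable]: "\<phi> z \<in> borel_measurable borel" for z
    unfolding \<phi>_def
    by (intro borel_measurable_continuous_on_indicator) (auto intro!: continuous_intros)
  \<comment> \<open>Translation invariance, for a general codomain because it is applied both to the
    complex functions and to their real norms.\<close>
  have shift: "integrable lborel (\<lambda>u. g (u - t))"
     "integral\<^sup>L lborel (\<lambda>u. g (u - t)) = integral\<^sup>L lborel g"
    if "integrable lborel g" for t and g :: "real \<Rightarrow> 'b::{banach, second_countable_topology}"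
    using lborel_integrable_real_affine[OF that, of 1 "-t"]
          lborel_integral_real_affine[of 1 g "-t"] by simp_all
  have prod: "integrable (lborel \<Otimes>\<^sub>M lborel) (case_prod (\<lambda>t u. \<phi> a t * \<phi> b (u - t)))"
  proof (rule lborel_pair.Fubini_integrable)
    show "case_prod (\<lambda>t u. \<phi> a t * \<phi> b (u - t)) \<in> borel_measurable (lborel \<Otimes>\<^sub>M lborel)"
      by measurable
    have "(\<lambda>t. LINT u|lborel. norm (case (t, u) of (t, u) \<Rightarrow> \<phi> a t * \<phi> b (u - t))) =
            (\<lambda>t. norm (\<phi> a t) * (LINT u|lborel. norm (\<phi> b u)))"
      using shift(2)[OF integrable_norm[OF \<phi>(1)[OF b]]] by (simp add: norm_mult)
    then show "integrable lborel (\<lambda>t. LINT u|lborel. norm (case (t, u) of (t, u) \<Rightarrow> \<phi> a t * \<phi> b (u - t)))"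
      using integrable_norm[OF \<phi>(1)[OF a]] by simp
    show "AE t in lborel. integrable lborel (\<lambda>u. case (t, u) of (t, u) \<Rightarrow> \<phi> a t * \<phi> b (u - t))"
      using shift(1)[OF \<phi>(1)[OF b]] by simp
  qed
  \<comment> \<open>The factors exp (-t) and exp (-(u - t)) combine to exp (-u), independent of
    \<open>t\<close>. What remains is the Beta integrand on (0, u); for u \<le> 0 the conditions t >
    0 and u - t > 0 exclude each other.\<close>
  have inner: "(LINT t|lborel. \<phi> a t * \<phi> b (u - t)) = \<phi> (a + b) u * B" for u
  proof (cases "u > 0")
    case True
    have eq: "\<phi> a t * \<phi> b (u - t) = indicator {0<..<u} t *\<^sub>R
           (complex_of_real t powr (a - 1) * complex_of_real (u - t) powr (b - 1)) * of_real (exp (-u))" for t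
      by (auto simp: \<phi>_def indicator_def exp_diff exp_minus field_simps)
    have "(LINT t|lborel. \<phi> a t * \<phi> b (u - t)) = complex_of_real u powr (a + b - 1) * B * of_real (exp (-u))"
      unfolding eq
      using has_bochner_integral_mult_left[OF has_bochner_integral_powr_mult_powr_aux[OF a b True]]
      by (simp add: has_bochner_integral_iff B_def)
    then show ?thesis
      using True by (simp add: \<phi>_def exp_minus field_simps)
  next
    case False
    then have eq: "\<phi> a t * \<phi> b (u - t) = 0" for t
      by (auto simp: \<phi>_def indicator_def)
    show ?thesis
      unfolding eq using False by (simp add: \<phi>_def)
  qed
  have "Gamma a * Gamma b = (LINT t|lborel. \<phi> a t * Gamma b)"
    using \<phi>[OF a] by simp
  also have "\<dots> = (LINT t|lborel. (LINT u|lborel. \<phi> a t * \<phi> b (u - t)))"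
    using shift(2)[OF \<phi>(1)[OF b]] by (simp add: \<phi>(2)[OF b])
  also have "\<dots> = (LINT u|lborel. (LINT t|lborel. \<phi> a t * \<phi> b (u - t)))"
    using lborel_pair.Fubini_integral[OF prod] by simp
  also have "\<dots> = Gamma (a + b) * B"
    using \<phi>[of "a + b"] a b by (simp add: inner)
  finally have "Gamma a * Gamma b = Gamma (a + b) * B" .
  moreover have "Gamma (a + b) \<noteq> 0"
    using a b by (intro Gamma_complex_nonzero) simp
  ultimately have "B = Beta a b"
    by (simp add: Beta_def field_simps)
  then show ?thesis
    using Beta_integrand_integrable[OF a b] by (simp add: has_bochner_integral_iff B_def)
qed

corollary has_bochner_integral_powr_mult_powr:
  fixes a b :: complex and u :: real
  assumes "Re a > 0" "Re b > 0" "u > 0"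
  shows "has_bochner_integral lborel (\<lambda>t. indicator {0<..<u} t *\<^sub>R
           (complex_of_real t powr (a - 1) * complex_of_real (u - t) powr (b - 1)))
           (complex_of_real u powr (a + b - 1) * Beta a b)"
  using has_bochner_integral_powr_mult_powr_aux[OF assms] has_bochner_integral_Beta[OF assms(1,2)]
  by (simp add: has_bochner_integral_iff)

text \<open>For a positive base only the real part of the exponent affects the modulus. The norm is
  cast back to a complex number so that the complex Beta integral can be reused at real
  parameters.\<close>

lemma norm_powr_mult_powr:
  fixes a b :: complex and u :: real
  defines "f \<equiv> \<lambda>a b t. indicator {0<..<u} t *\<^sub>R
           (complex_of_real t powr a * complex_of_real (u - t) powr b)"
  shows "complex_of_real (norm (f a b t)) = f (complex_of_real (Re a)) (complex_of_real (Re b)) t"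
proof (cases "0 < t \<and> t < u")
  case True
  then have "complex_of_real (u - t) powr complex_of_real (Re b) = complex_of_real ((u - t) powr Re b)"
    by (intro powr_of_real) auto
  moreover have "norm (complex_of_real (u - t) powr b) = (u - t) powr Re b"
    using True by (subst norm_powr_real_powr) (auto simp del: of_real_diff)
  ultimately show ?thesis
    using True by (simp add: f_def norm_mult norm_powr_real_powr powr_of_real del: of_real_diff)
qed (auto simp: f_def)

lemma norm_powr_mult_powr_has_bochner_integral:
  fixes a b :: complex and u :: real
  assumes "Re a > 0" "Re b > 0" "u > 0"
  shows "has_bochner_integral lborel (\<lambda>t. norm (indicator {0<..<u} t *\<^sub>R
           (complex_of_real t powr (a - 1) * complex_of_real (u - t) powr (b - 1))))
           (u powr (Re a + Re b - 1) * Beta (Re a) (Re b))"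
proof -
  let ?f = "\<lambda>a b t. indicator {0<..<u} t *\<^sub>R
           (complex_of_real t powr (a - 1) * complex_of_real (u - t) powr (b - 1))"
  let ?a = "complex_of_real (Re a)" and ?b = "complex_of_real (Re b)"
  have eq: "complex_of_real (norm (?f a b t)) = ?f ?a ?b t" for t
    using norm_powr_mult_powr[of u t "a - 1" "b - 1"]
    by (simp only: minus_complex.sel one_complex.sel of_real_diff of_real_1)
  have c: "complex_of_real u powr (?a + ?b - 1) = complex_of_real (u powr (Re a + Re b - 1))"
    using assms(3) by (subst powr_of_real[symmetric]) auto
  have "has_bochner_integral lborel (\<lambda>t. complex_of_real (norm (?f a b t)))
          (complex_of_real (u powr (Re a + Re b - 1) * Beta (Re a) (Re b)))"
    unfolding eq using has_bochner_integral_powr_mult_powr[of ?a ?b u] assms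
    by (simp only: c Beta_complex_of_real of_real_mult Re_complex_of_real)
  from has_bochner_integral_Re[OF this] show ?thesis
    by (simp only: Re_complex_of_real)
qed

text \<open>The triangle inequality for integrals, applied to the Beta integral; the integral of the
  norm is again a Beta integral.\<close>

lemma norm_Beta_le:
  fixes a b :: complex
  assumes "Re a > 0" "Re b > 0"
  shows "norm (Beta a b) \<le> Beta (Re a) (Re b)"
proof -
  let ?f = "\<lambda>t. indicator {0<..<1} t *\<^sub>R
           (complex_of_real t powr (a - 1) * complex_of_real (1 - t) powr (b - 1))"
  have "Beta a b = integral\<^sup>L lborel ?f"
    using has_bochner_integral_Beta[OF assms] by (rule has_bochner_integral_integral_eq[symmetric])
  also have "norm \<dots> \<le> (LINT t|lborel. norm (?f t))"
    by (rule integral_norm_bound)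
  also have "\<dots> = Beta (Re a) (Re b)"
    using has_bochner_integral_integral_eq[OF norm_powr_mult_powr_has_bochner_integral[OF assms zero_less_one]]
    by (simp only: powr_one_eq_one mult_1_left)
  finally show ?thesis .
qed

subsection \<open>Absolute convergence of the triple series\<close>

text \<open>This is \<open>norm_Beta_le\<close> with both Beta functions written through Gamma and
  the factors rearranged.\<close>

lemma rGamma_ratio_add_le:
  fixes z w :: complex
  assumes "Re z > 0" "Re w > 0"
  shows "norm (rGamma (z + w)) * Gamma (Re (z + w)) \<le>
           (norm (rGamma z) * Gamma (Re z)) * (norm (rGamma w) * Gamma (Re w))"
proof -
  have nz: "Gamma z \<noteq> 0" "Gamma w \<noteq> 0"
    using assms by (simp_all add: Gamma_complex_nonzero)
  have pos: "Gamma (Re z + Re w) > 0"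
    using assms by (intro Gamma_real_pos) auto
  have "norm (Gamma z) * norm (Gamma w) * norm (rGamma (z + w)) \<le>
          Gamma (Re z) * Gamma (Re w) / Gamma (Re z + Re w)"
    using norm_Beta_le[OF assms] by (simp add: Beta_def norm_mult norm_divide rGamma_inverse_Gamma norm_inverse divide_inverse)
  then show ?thesis
    using nz pos by (simp add: rGamma_inverse_Gamma norm_inverse norm_divide field_simps)
qed

lemma rGamma_ratio_add_multiple_le:
  fixes z w :: complex
  assumes "Re z > 0" "Re w > 0"
  shows "norm (rGamma (of_nat n * z + w)) * Gamma (Re (of_nat n * z + w)) \<le>
           (norm (rGamma z) * Gamma (Re z)) ^ n * (norm (rGamma w) * Gamma (Re w))"
proof (induction n)
  case (Suc n)
  have "norm (rGamma (z + (of_nat n * z + w))) * Gamma (Re (z + (of_nat n * z + w))) \<le>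
          (norm (rGamma z) * Gamma (Re z)) *
          (norm (rGamma (of_nat n * z + w)) * Gamma (Re (of_nat n * z + w)))"
    using assms by (intro rGamma_ratio_add_le) (auto intro: add_nonneg_pos)
  also have "\<dots> \<le> (norm (rGamma z) * Gamma (Re z)) *
          ((norm (rGamma z) * Gamma (Re z)) ^ n * (norm (rGamma w) * Gamma (Re w)))"
    using Suc.IH Gamma_real_pos[OF assms(1)] by (intro mult_left_mono) auto
  finally show ?case
    by (simp add: algebra_simps)
qed simp

text \<open>Integrating only over \<open>[R, R + 1]\<close> already shows that the Gamma function outgrows every
  exponential.\<close>

lemma Gamma_real_ge:
  fixes x R :: real
  assumes "x > 0" "R > 0"
  shows "R powr x \<le> (R + 1) * exp (R + 1) * Gamma x"
proof -
  let ?f = "\<lambda>t. t powr (x - 1) / exp t" and ?c = "R powr x / ((R + 1) * exp (R + 1))"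
  have int: "?f integrable_on {R..R + 1}"
    using assms by (intro integrable_continuous_interval continuous_intros) auto
  have le: "?c \<le> ?f t" if "t \<in> {R..R + 1}" for t
  proof -
    \<comment> \<open>Writing t powr (x - 1) as t powr x / t avoids a case split on the sign of x -
      1: the numerator is smallest at \<open>R\<close>, the denominator t * exp t largest at R +
      1.\<close>
    have "R powr x / ((R + 1) * exp (R + 1)) \<le> t powr x / (t * exp t)"
      using assms that by (intro frac_le mult_mono powr_mono2) auto
    then show ?thesis
      using assms that by (simp add: powr_diff)
  qed
  have "?c = integral {R..R + 1} (\<lambda>_. ?c)"
    by simp
  also have "\<dots> \<le> integral {R..R + 1} ?f"
    using int le by (intro integral_le) auto
  also have "\<dots> \<le> Gamma x"
    using Gamma_integral_real[OF assms(1)] int assms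
    by (intro has_integral_subset_le[of "{R..R + 1}" "{0..}" ?f]) (auto simp: integrable_integral)
  finally show ?thesis
    using assms by (simp add: field_simps add_pos_pos)
qed

text \<open>Submultiplicativity bounds \<open>q\<close> geometrically, and
  \<open>Gamma_real_ge\<close> replaces 1 / Gamma (Re z) by a constant times R powr (- Re z). Since
  \<open>R\<close> is free, the three geometric bases can later be made as small as desired.\<close>

lemma norm_rGamma_le:
  fixes \<alpha> \<beta> \<gamma> \<delta> :: complex and R :: real
  assumes "Re \<alpha> > 0" "Re \<beta> > 0" "Re \<gamma> > 0" "Re \<delta> > 0" "R > 0"
  defines "q \<equiv> \<lambda>z. norm (rGamma z) * Gamma (Re z)"
  shows "norm (rGamma (of_nat l * \<alpha> + of_nat p * \<beta> + of_nat k * \<gamma> + \<delta>)) \<le>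
           (R + 1) * exp (R + 1) * R powr (- Re \<delta>) * q \<delta> *
             ((q \<alpha> * R powr (- Re \<alpha>)) ^ l * (q \<beta> * R powr (- Re \<beta>)) ^ p * (q \<gamma> * R powr (- Re \<gamma>)) ^ k)"
proof -
  define z where "z = of_nat l * \<alpha> + (of_nat p * \<beta> + (of_nat k * \<gamma> + \<delta>))"
  define C where "C = (R + 1) * exp (R + 1)"
  have C: "C > 0" using assms(5) by (simp add: C_def)
  have q: "q x \<ge> 0" if "Re x > 0" for x
    using Gamma_real_pos[OF that] by (simp add: q_def)
  have 1: "Re (of_nat k * \<gamma> + \<delta>) > 0"
    using assms by (simp add: add_nonneg_pos)
  then have 2: "Re (of_nat p * \<beta> + (of_nat k * \<gamma> + \<delta>)) > 0"
    using assms by (subst plus_complex.sel(1)) (intro add_nonneg_pos, auto)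
  then have z: "Re z > 0"
    unfolding z_def using assms by (subst plus_complex.sel(1)) (intro add_nonneg_pos, auto)
  \<comment> \<open>The right-nested bracketing of \<open>z\<close> allows the multiples of
    \<alpha>, \<beta> and \<gamma> to be peeled off one after another, each time leaving a summand
    with positive real part.\<close>
  have "q z \<le> q \<alpha> ^ l * q (of_nat p * \<beta> + (of_nat k * \<gamma> + \<delta>))"
    unfolding q_def z_def using assms 2 by (intro rGamma_ratio_add_multiple_le) auto
  also have "q (of_nat p * \<beta> + (of_nat k * \<gamma> + \<delta>)) \<le> q \<beta> ^ p * q (of_nat k * \<gamma> + \<delta>)"
    unfolding q_def using assms 1 by (intro rGamma_ratio_add_multiple_le) auto
  also have "q (of_nat k * \<gamma> + \<delta>) \<le> q \<gamma> ^ k * q \<delta>"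
    unfolding q_def using assms by (intro rGamma_ratio_add_multiple_le) auto
  finally have qz: "q z \<le> q \<alpha> ^ l * (q \<beta> ^ p * (q \<gamma> ^ k * q \<delta>))"
    using q assms by (auto simp: mult_left_mono)
  have "norm (rGamma z) * R powr (Re z) \<le> norm (rGamma z) * (C * Gamma (Re z))"
    unfolding C_def using Gamma_real_ge[OF z assms(5)] by (intro mult_left_mono) auto
  also have "\<dots> = C * q z"
    by (simp add: q_def)
  also have "\<dots> \<le> C * (q \<alpha> ^ l * (q \<beta> ^ p * (q \<gamma> ^ k * q \<delta>)))"
    using qz C by (intro mult_left_mono) auto
  finally have "norm (rGamma z) * R powr (Re z) * R powr (- Re z) \<le>
                  C * (q \<alpha> ^ l * (q \<beta> ^ p * (q \<gamma> ^ k * q \<delta>))) * R powr (- Re z)"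
    by (intro mult_right_mono) auto
  also have "norm (rGamma z) * R powr (Re z) * R powr (- Re z) = norm (rGamma z)"
    using assms(5) by (simp add: mult.assoc powr_add[symmetric])
  also have "R powr (- Re z) = (R powr (- Re \<alpha>)) ^ l * (R powr (- Re \<beta>)) ^ p * (R powr (- Re \<gamma>)) ^ k * R powr (- Re \<delta>)"
    using assms(5) by (simp add: z_def powr_realpow[symmetric] powr_powr powr_add[symmetric] algebra_simps)
  finally show ?thesis
    by (simp add: z_def C_def power_mult_distrib add.assoc mult_ac)
qed

section \<open>Factorial bounds for the numerators\<close>

text \<open>Each new factor satisfies |\<eta> + n| \<le> n + M + 1, which is exactly the factor
  leading from (n + M)! to (n + 1 + M)!.\<close>

lemma norm_pochhammer_le_fact:
  fixes \<eta> :: complex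
  assumes "norm \<eta> \<le> 1 + real M"
  shows "norm (pochhammer \<eta> n) \<le> fact (n + M)"
proof (induction n)
  case (Suc n)
  have "norm (\<eta> + of_nat n) \<le> 1 + real M + real n"
    using norm_triangle_ineq[of \<eta> "of_nat n"] assms by simp
  then have "norm (pochhammer \<eta> n) * norm (\<eta> + of_nat n) \<le> fact (n + M) * (1 + real M + real n)"
    using Suc.IH by (intro mult_mono) auto
  moreover have "fact (Suc n + M) = fact (n + M) * (1 + real M + real n)"
    by (simp add: algebra_simps)
  ultimately show ?case
    by (simp only: pochhammer_Suc norm_mult)
qed (simp add: fact_ge_1)

lemma fact_add_le: "fact (i + j) \<le> (2 ^ (i + j) * (fact i * fact j) :: real)"
proof -
  have "fact (i + j) = real ((i + j) choose i) * (fact i * fact j)"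
    using binomial_fact[of i "i + j", where ?'a = real] by simp
  also have "real ((i + j) choose i) \<le> 2 ^ (i + j)"
    using binomial_le_pow2[of "i + j" i] by (metis of_nat_le_iff of_nat_numeral of_nat_power)
  finally show ?thesis
    by (simp add: mult_right_mono)
qed

text \<open>Splitting off \<open>l\<close>, then \<open>p\<close>, then \<open>k\<close> costs a
  power of 2 for everything still in the sum: \<open>l\<close> pays once, \<open>p\<close> twice,
  \<open>k\<close> and \<open>M\<close> three times. The factorials on the right cancel the
  denominators of the series.\<close>

lemma fact_add4_le:
  "fact (l + p + k + M) \<le>
     (8 ^ M * fact M * (2 ^ l * 4 ^ p * 8 ^ k) * (fact l * fact p * fact k) :: real)"
proof -
  have "fact (l + (p + (k + M))) \<le> (2 ^ (l + (p + (k + M))) * (fact l * fact (p + (k + M))) :: real)"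
    by (rule fact_add_le)
  also have "fact (p + (k + M)) \<le> (2 ^ (p + (k + M)) * (fact p * fact (k + M)) :: real)"
    by (rule fact_add_le)
  also have "fact (k + M) \<le> (2 ^ (k + M) * (fact k * fact M) :: real)"
    by (rule fact_add_le)
  finally have "fact (l + (p + (k + M))) \<le> (2 ^ (l + (p + (k + M))) * (fact l *
      (2 ^ (p + (k + M)) * (fact p * (2 ^ (k + M) * (fact k * fact M))))) :: real)"
    by (simp add: mult_left_mono)
  also have "\<dots> = (2 * 2 * 2) ^ M * fact M * (2 ^ l * (2 * 2) ^ p * (2 * 2 * 2) ^ k) * (fact l * fact p * fact k)"
    unfolding power_add power_mult_distrib by (simp only: mult_ac)
  finally show ?thesis
    by (simp add: add.assoc)
qed

section \<open>Summability over index triples\<close>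

lemma summable_on_times_nonneg:
  fixes f :: "'a \<Rightarrow> real" and g :: "'b \<Rightarrow> real"
  assumes "f summable_on A" "g summable_on B" "\<And>x. x \<in> A \<Longrightarrow> f x \<ge> 0" "\<And>x. x \<in> B \<Longrightarrow> g x \<ge> 0"
  shows "(\<lambda>(x, y). f x * g y) summable_on A \<times> B"
proof (rule summable_on_SigmaI)
  fix x assume "x \<in> A"
  show "((\<lambda>y. case (x, y) of (x, y) \<Rightarrow> f x * g y) has_sum (f x * infsum g B)) B"
    using assms(2) by (auto intro!: has_sum_cmult_right has_sum_infsum)
next
  show "(\<lambda>x. f x * infsum g B) summable_on A"
    using assms(1) by (intro summable_on_cmult_left)
qed (use assms in auto)

lemma summable_on_geometric3:
  fixes x y z :: real
  assumes "0 \<le> x" "x < 1" "0 \<le> y" "y < 1" "0 \<le> z" "z < 1"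
  shows "(\<lambda>(l, p, k). x ^ l * y ^ p * z ^ k) summable_on UNIV"
proof -
  have geo: "(\<lambda>n. r ^ n) summable_on UNIV" if "0 \<le> r" "r < 1" for r :: real
    using that by (subst summable_on_UNIV_nonneg_real_iff) auto
  have "(\<lambda>(l, i). x ^ l * (case i of (p, k) \<Rightarrow> y ^ p * z ^ k)) summable_on UNIV \<times> (UNIV \<times> UNIV)"
    using assms by (intro summable_on_times_nonneg geo) auto
  then show ?thesis
    by (simp add: case_prod_unfold mult.assoc)
qed

text \<open>The reciprocal Gamma factor is left out because it is the only place where \<delta>
  enters; one coefficient family then serves every shift of \<delta>.\<close>

definition ml3_coeff :: "complex \<Rightarrow> nat \<times> nat \<times> nat \<Rightarrow> complex" where
  "ml3_coeff \<eta> = (\<lambda>(l, p, k). pochhammer \<eta> (l + p + k) / (fact l * fact p * fact k))"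

definition ml3_exponent :: "complex \<Rightarrow> complex \<Rightarrow> complex \<Rightarrow> nat \<times> nat \<times> nat \<Rightarrow> complex" where
  "ml3_exponent \<alpha> \<beta> \<gamma> = (\<lambda>(l, p, k). of_nat l * \<alpha> + of_nat p * \<beta> + of_nat k * \<gamma>)"

text \<open>Polymorphic because it is used at the complex variables and at their real
  moduli.\<close>

definition monomial3 :: "'a::comm_monoid_mult \<Rightarrow> 'a \<Rightarrow> 'a \<Rightarrow> nat \<times> nat \<times> nat \<Rightarrow> 'a" where
  "monomial3 u v w = (\<lambda>(l, p, k). u ^ l * v ^ p * w ^ k)"

text \<open>The terms are dominated by a triple geometric series whose bases tend to 0 as
  \<open>R\<close> grows, so a large \<open>R\<close> makes all three less than 1.\<close>

lemma ml3_abs_summable_Re_pos: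
  fixes \<alpha> \<beta> \<gamma> \<delta> \<eta> :: complex and u v w :: real
  assumes "Re \<alpha> > 0" "Re \<beta> > 0" "Re \<gamma> > 0" "Re \<delta> > 0" "u \<ge> 0" "v \<ge> 0" "w \<ge> 0"
  shows "(\<lambda>j. norm (ml3_coeff \<eta> j * rGamma (ml3_exponent \<alpha> \<beta> \<gamma> j + \<delta>)) * monomial3 u v w j)
           summable_on UNIV"
proof -
  define q where "q = (\<lambda>z::complex. norm (rGamma z) * Gamma (Re z))"
  have q: "q x \<ge> 0" if "Re x > 0" for x
    using Gamma_real_pos[OF that] by (simp add: q_def)
  \<comment> \<open>The factors 2, 4, 8 are those of \<open>fact_add4_le\<close>; the rest is a base
    from \<open>norm_rGamma_le\<close> times the variable.\<close>
  define x where "x = (\<lambda>R. 2 * (q \<alpha> * R powr (- Re \<alpha>)) * u)"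
  define y where "y = (\<lambda>R. 4 * (q \<beta> * R powr (- Re \<beta>)) * v)"
  define z where "z = (\<lambda>R. 8 * (q \<gamma> * R powr (- Re \<gamma>)) * w)"
  have lim: "((\<lambda>R. c * (q \<zeta> * R powr (- Re \<zeta>)) * t) \<longlongrightarrow> c * (q \<zeta> * 0) * t) at_top"
    if "Re \<zeta> > 0" for c t \<zeta>
    using that by (intro tendsto_intros tendsto_neg_powr filterlim_ident) auto
  have "(x \<longlongrightarrow> 0) at_top" "(y \<longlongrightarrow> 0) at_top" "(z \<longlongrightarrow> 0) at_top"
    unfolding x_def y_def z_def using lim assms by simp_all
  then have "eventually (\<lambda>R. x R < 1 \<and> y R < 1 \<and> z R < 1 \<and> R > 0) at_top"
    by (intro eventually_conj order_tendstoD eventually_gt_at_top) auto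
  then obtain R where R: "x R < 1" "y R < 1" "z R < 1" "R > 0"
    using eventually_happens' trivial_limit_at_top_linorder by blast
  obtain M :: nat where M: "norm \<eta> \<le> real M"
    using real_arch_simple by blast
  define K where "K = 8 ^ M * fact M * ((R + 1) * exp (R + 1) * R powr (- Re \<delta>) * q \<delta>)"
  have S: "(\<lambda>j. K * monomial3 (x R) (y R) (z R) j) summable_on UNIV"
    unfolding monomial3_def using R q assms
    by (intro summable_on_cmult_right summable_on_geometric3) (auto simp: x_def y_def z_def)
  have le: "norm (norm (ml3_coeff \<eta> j * rGamma (ml3_exponent \<alpha> \<beta> \<gamma> j + \<delta>)) * monomial3 u v w j)
                   \<le> K * monomial3 (x R) (y R) (z R) j" for j
  proof -
    obtain l p k where j: "j = (l, p, k)"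
      by (cases j)
    let ?A = "8 ^ M * fact M * (2 ^ l * 4 ^ p * 8 ^ k) :: real"
    let ?B = "(R + 1) * exp (R + 1) * R powr (- Re \<delta>) * q \<delta> *
             ((q \<alpha> * R powr (- Re \<alpha>)) ^ l * (q \<beta> * R powr (- Re \<beta>)) ^ p * (q \<gamma> * R powr (- Re \<gamma>)) ^ k)"
    have "norm (pochhammer \<eta> (l + p + k)) \<le> fact (l + p + k + M)"
      using M by (intro norm_pochhammer_le_fact) auto
    also have "\<dots> \<le> ?A * (fact l * fact p * fact k)"
      by (rule fact_add4_le)
    finally have 1: "norm (ml3_coeff \<eta> j) \<le> ?A"
      by (simp add: j ml3_coeff_def norm_divide norm_mult pos_divide_le_eq)
    have 2: "norm (rGamma (ml3_exponent \<alpha> \<beta> \<gamma> j + \<delta>)) \<le> ?B"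
      using norm_rGamma_le[OF assms(1-4) R(4), of l p k] by (simp add: j ml3_exponent_def q_def)
    have "norm (ml3_coeff \<eta> j * rGamma (ml3_exponent \<alpha> \<beta> \<gamma> j + \<delta>)) * monomial3 u v w j \<le>
            (?A * ?B) * monomial3 u v w j"
      unfolding norm_mult using assms
      by (intro mult_right_mono mult_mono 1 2) (auto simp: monomial3_def j)
    also have "\<dots> = K * monomial3 (x R) (y R) (z R) j"
      by (simp add: K_def monomial3_def j x_def y_def z_def power_mult_distrib mult_ac)
    finally show ?thesis
      using assms by (simp add: monomial3_def j norm_mult abs_mult)
  qed
  have "(\<lambda>j. norm (norm (ml3_coeff \<eta> j * rGamma (ml3_exponent \<alpha> \<beta> \<gamma> j + \<delta>)) * monomial3 u v w j)) summable_on UNIV"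
    by (rule Infinite_Sum.abs_summable_on_comparison_test'[OF S le])
  then show ?thesis
    by (rule abs_summable_summable)
qed

text \<open>The recurrence \<open>1/\<Gamma>(z) = z/\<Gamma>(z + 1)\<close> lowers \<open>\<delta>\<close> by one; the factor \<open>z\<close> grows linearly
  and is absorbed by doubling \<open>u\<close>, \<open>v\<close>, \<open>w\<close>.\<close>

lemma ml3_abs_summable:
  fixes \<alpha> \<beta> \<gamma> \<delta> \<eta> :: complex and u v w :: real
  assumes "Re \<alpha> > 0" "Re \<beta> > 0" "Re \<gamma> > 0" "u \<ge> 0" "v \<ge> 0" "w \<ge> 0"
  shows "(\<lambda>j. norm (ml3_coeff \<eta> j * rGamma (ml3_exponent \<alpha> \<beta> \<gamma> j + \<delta>)) * monomial3 u v w j)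
           summable_on UNIV"
proof -
  \<comment> \<open>\<open>N\<close> is a number of unit shifts after which \<delta> has positive
    real part. The induction on it generalises \<open>u\<close>, \<open>v\<close>, \<open>w\<close>,
    since each step doubles them.\<close>
  obtain N :: nat where "- Re \<delta> < real N"
    using reals_Archimedean2 by blast
  then have "Re (\<delta> + of_nat N) > 0"
    by simp
  then show ?thesis
    using assms(4-6)
  proof (induction N arbitrary: \<delta> u v w)
    case 0
    then show ?case
      using assms by (intro ml3_abs_summable_Re_pos) auto
  next
    case (Suc N)
    let ?s = "ml3_exponent \<alpha> \<beta> \<gamma>"
    \<comment> \<open>Since n \<le> 2 ^ n, the linear factor |s_j + \<delta>| is at most K * 2 ^ l *
      2 ^ p * 2 ^ k.\<close>
    define K where "K = norm \<alpha> + norm \<beta> + norm \<gamma> + norm \<delta>"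
    have "(\<lambda>j. norm (ml3_coeff \<eta> j * rGamma (?s j + (\<delta> + 1))) * monomial3 (2 * u) (2 * v) (2 * w) j)
            summable_on UNIV"
      using Suc.prems by (intro Suc.IH) (auto simp: algebra_simps)
    then have S: "(\<lambda>j. K * (norm (ml3_coeff \<eta> j * rGamma (?s j + (\<delta> + 1))) * monomial3 (2 * u) (2 * v) (2 * w) j))
            summable_on UNIV"
      by (rule summable_on_cmult_right)
    have bound: "norm (norm (ml3_coeff \<eta> j * rGamma (?s j + \<delta>)) * monomial3 u v w j) \<le>
      K * (norm (ml3_coeff \<eta> j * rGamma (?s j + (\<delta> + 1))) * monomial3 (2 * u) (2 * v) (2 * w) j)" for j
    proof -
      obtain l p k where j: "j = (l, p, k)"
        by (cases j)
      have m: "monomial3 u v w j \<ge> 0"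
        using Suc.prems by (simp add: monomial3_def j)
      let ?P = "2 ^ l * 2 ^ p * 2 ^ k :: real"
      have pw: "real l \<le> ?P" "real p \<le> ?P" "real k \<le> ?P" "1 \<le> ?P"
      proof -
        have "2 ^ l * 1 * 1 \<le> ?P" "1 * 2 ^ p * 1 \<le> ?P" "1 * 1 * 2 ^ k \<le> ?P" "1 * 1 * 1 \<le> ?P"
          by (intro mult_mono; simp)+
        then show "real l \<le> ?P" "real p \<le> ?P" "real k \<le> ?P" "1 \<le> ?P"
          using of_nat_less_two_power[of l, where ?'a = real] of_nat_less_two_power[of p, where ?'a = real]
            of_nat_less_two_power[of k, where ?'a = real] by linarith+
      qed
      have "norm (?s j + \<delta>) \<le> real l * norm \<alpha> + real p * norm \<beta> + real k * norm \<gamma> + 1 * norm \<delta>"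
        unfolding ml3_exponent_def j prod.case
        by (intro order.trans[OF norm_triangle_ineq] add_mono) (simp_all add: norm_mult)
      also have "\<dots> \<le> ?P * norm \<alpha> + ?P * norm \<beta> + ?P * norm \<gamma> + ?P * norm \<delta>"
        using pw by (intro add_mono mult_right_mono) auto
      also have "\<dots> = K * ?P"
        by (simp add: K_def algebra_simps)
      finally have s: "norm (?s j + \<delta>) \<le> K * ?P" .
      have "rGamma (?s j + \<delta>) = (?s j + \<delta>) * rGamma (?s j + (\<delta> + 1))"
        using rGamma_plus1[of "?s j + \<delta>"] by (simp add: add.assoc)
      then have "norm (ml3_coeff \<eta> j * rGamma (?s j + \<delta>)) * monomial3 u v w j =
          norm (?s j + \<delta>) * (norm (ml3_coeff \<eta> j * rGamma (?s j + (\<delta> + 1))) * monomial3 u v w j)"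
        by (simp add: norm_mult mult_ac)
      also have "\<dots> \<le> (K * ?P) * (norm (ml3_coeff \<eta> j * rGamma (?s j + (\<delta> + 1))) * monomial3 u v w j)"
        using m s by (intro mult_right_mono) auto
      also have "\<dots> = K * (norm (ml3_coeff \<eta> j * rGamma (?s j + (\<delta> + 1))) * monomial3 (2 * u) (2 * v) (2 * w) j)"
        by (simp add: monomial3_def j power_mult_distrib mult_ac)
      finally show ?thesis
        using m by (simp add: abs_mult)
    qed
    have "(\<lambda>j. norm (norm (ml3_coeff \<eta> j * rGamma (?s j + \<delta>)) * monomial3 u v w j)) summable_on UNIV"
      by (rule Infinite_Sum.abs_summable_on_comparison_test'[OF S bound])
    then show ?case
      by (rule abs_summable_summable)
  qed
qed

section \<open>From iterated series to unordered sums\<close>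

lemma suminf_eq_infsum:
  fixes f :: "nat \<Rightarrow> 'a::{comm_monoid_add, t2_space}"
  shows "f summable_on UNIV \<Longrightarrow> suminf f = infsum f UNIV"
  by (metis has_sum_imp_sums has_sum_infsum sums_unique)

text \<open>Fubini for unordered sums, applied once to the pair of inner indices and once to the
  outer one. It frees the nested series of \<open>mittag_leffler3\<close> from its order, so that
  the triples may be enumerated arbitrarily.\<close>

lemma suminf_suminf_suminf_eq_infsum:
  fixes f :: "nat \<times> nat \<times> nat \<Rightarrow> complex"
  assumes "f summable_on UNIV"
  shows "(\<Sum>l. \<Sum>p. \<Sum>k. f (l, p, k)) = infsum f UNIV"
proof -
  have 1: "f summable_on Sigma UNIV (\<lambda>_. UNIV)"
    using assms by simp
  have 2: "(\<lambda>q. f (l, q)) summable_on UNIV" for l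
    using summable_on_SigmaD1[of "\<lambda>x y. f (x, y)" UNIV "\<lambda>_. UNIV" l] 1 by simp
  then have 3: "(\<lambda>q. f (l, q)) summable_on Sigma UNIV (\<lambda>_. UNIV)" for l
    by simp
  have 4: "(\<lambda>k. f (l, p, k)) summable_on UNIV" for l p
    using summable_on_SigmaD1[of "\<lambda>x y. f (l, x, y)" UNIV "\<lambda>_. UNIV" p] 3[of l] by (simp add: case_prod_unfold)
  have "(\<Sum>l. \<Sum>p. \<Sum>k. f (l, p, k)) = (\<Sum>l. \<Sum>p. infsum (\<lambda>k. f (l, p, k)) UNIV)"
    using 4 by (simp add: suminf_eq_infsum)
  also have "\<dots> = (\<Sum>l. infsum (\<lambda>q. f (l, q)) UNIV)"
    using infsum_Sigma_banach[OF 3] summable_on_SigmaD[OF 3 4]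
    by (simp add: suminf_eq_infsum)
  also have "\<dots> = infsum f UNIV"
    using infsum_Sigma_banach[OF 1] summable_on_SigmaD[OF 1 2]
    by (simp add: suminf_eq_infsum)
  finally show ?thesis .
qed

subsection \<open>Fractional power series\<close>

text \<open>The operators only see a single series with complex exponents, so the triple index is
  hidden here. Summability is required for every \<delta>, without a sign condition, because
  differentiation lowers \<delta> and \<delta> - \<nu> may have any real part.\<close>

locale fractional_power_series =
  fixes c s :: "nat \<Rightarrow> complex"
  assumes Re_exponent_nonneg: "\<And>j. Re (s j) \<ge> 0"
    and summable_coeffs:
      "\<And>\<delta> T. T > 0 \<Longrightarrow> summable (\<lambda>j. norm (c j * rGamma (s j + \<delta>)) * T powr Re (s j))"
begin

definition coeff :: "complex \<Rightarrow> nat \<Rightarrow> complex" where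
  "coeff \<delta> j = c j * rGamma (s j + \<delta>)"

definition series_fun :: "complex \<Rightarrow> real \<Rightarrow> complex" where
  "series_fun \<delta> x = (\<Sum>j. coeff \<delta> j * complex_of_real x powr (s j + \<delta> - 1))"

lemma norm_term:
  assumes "x > 0"
  shows "norm (coeff \<delta> j * complex_of_real x powr (s j + \<epsilon>)) =
           norm (coeff \<delta> j) * x powr Re (s j) * x powr Re \<epsilon>"
  using assms by (simp add: norm_mult norm_powr_real_powr powr_add)

lemma summable_norm_term:
  assumes "x > 0"
  shows "summable (\<lambda>j. norm (coeff \<delta> j * complex_of_real x powr (s j + \<epsilon>)))"
  unfolding norm_term[OF assms] using summable_coeffs[OF assms, of \<delta>]
  by (intro summable_mult2) (simp add: coeff_def)

text \<open>Beta contributes Gamma (s_j + \<delta>), which cancels the old reciprocal Gamma factor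
  and leaves the one for \<delta> + \<nu>. Positivity of the real part keeps s_j + \<delta> away
  from the poles, where \<open>Gamma\<close> is 0 by convention.\<close>

lemma coeff_mult_Beta:
  assumes "Re \<delta> > 0" "Re \<nu> > 0"
  shows "coeff \<delta> j * Beta (s j + \<delta>) \<nu> = Gamma \<nu> * coeff (\<delta> + \<nu>) j"
proof -
  have "Gamma (s j + \<delta>) \<noteq> 0"
    using assms Re_exponent_nonneg[of j] by (intro Gamma_complex_nonzero) simp
  then show ?thesis
    by (simp add: coeff_def Beta_altdef rGamma_inverse_Gamma[of "s j + \<delta>"] add.assoc)
qed

section \<open>Termwise fractional integration\<close>

text \<open>Each term is a Beta integral, and sum and integral may be exchanged because the
  integrals of the norms are summable. The same fact yields integrability.\<close>

lemma RL_integral_series_fun: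
  assumes "Re \<delta> > 0" "Re \<nu> > 0" "y > a" and g: "\<And>r. r > a \<Longrightarrow> g r = series_fun \<delta> (r - a)"
  shows "RL_integrable a \<nu> g y \<and> RL_integral a \<nu> g y = series_fun (\<delta> + \<nu>) (y - a)"
proof -
  define u where "u = y - a"
  have u: "u > 0"
    using assms by (simp add: u_def)
  define h where "h = (\<lambda>j t. indicator {0<..<u} t *\<^sub>R
           (complex_of_real t powr (s j + \<delta> - 1) * complex_of_real (u - t) powr (\<nu> - 1)))"
  \<comment> \<open>The argument is t - a, written as an affine map to match the change of variables
    that moves (0, u) to (a, y).\<close>
  define F where "F = (\<lambda>j t. coeff \<delta> j * h j (- a + 1 * t))"
  have Re_pos: "Re (s j + \<delta>) > 0" for j
    using assms Re_exponent_nonneg[of j] by simp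
  have "has_bochner_integral lborel (\<lambda>t. h j (- a + 1 * t))
          ((u powr (s j + \<delta> + \<nu> - 1) * Beta (s j + \<delta>) \<nu>) /\<^sub>R \<bar>1\<bar>)" for j
    unfolding h_def
    by (subst lborel_has_bochner_integral_real_affine_iff[symmetric])
       (use has_bochner_integral_powr_mult_powr[OF Re_pos assms(2) u] in auto)
  then have "has_bochner_integral lborel (F j)
          (coeff \<delta> j * (u powr (s j + \<delta> + \<nu> - 1) * Beta (s j + \<delta>) \<nu>))" for j
    unfolding F_def by (intro has_bochner_integral_mult_right) simp
  then have F_has: "has_bochner_integral lborel (F j)
          (Gamma \<nu> * (coeff (\<delta> + \<nu>) j * u powr (s j + (\<delta> + \<nu>) - 1)))" for j
    using coeff_mult_Beta[OF assms(1,2), of j] by (metis (no_types, lifting) add.assoc mult.assoc mult.commute)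
  have "has_bochner_integral lborel (\<lambda>t. norm (h j (- a + 1 * t)))
          ((u powr (Re (s j + \<delta>) + Re \<nu> - 1) * Beta (Re (s j + \<delta>)) (Re \<nu>)) /\<^sub>R \<bar>1\<bar>)" for j
    unfolding h_def
    by (subst lborel_has_bochner_integral_real_affine_iff[symmetric])
       (use norm_powr_mult_powr_has_bochner_integral[OF Re_pos assms(2) u] in auto)
  then have F_norm: "has_bochner_integral lborel (\<lambda>t. norm (F j t))
          (norm (coeff \<delta> j) * (u powr (Re (s j + \<delta>) + Re \<nu> - 1) * Beta (Re (s j + \<delta>)) (Re \<nu>)))" for j
    unfolding F_def norm_mult by (intro has_bochner_integral_mult_right) simp
  have int: "integrable lborel (F j)" for j
    using F_has by (simp add: has_bochner_integral_iff)
  have F_eq: "F j t = indicator {a<..<y} t *\<^sub>R (complex_of_real (y - t) powr (\<nu> - 1) *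
       (coeff \<delta> j * complex_of_real (t - a) powr (s j + (\<delta> - 1))))" for j t
    by (auto simp: F_def h_def u_def indicator_def algebra_simps)
  have "summable (\<lambda>j. norm (F j t))" for t
  proof (cases "a < t \<and> t < y")
    case True
    then show ?thesis
      unfolding F_eq using summable_norm_term[of "t - a" \<delta> "\<delta> - 1"]
      by (simp add: norm_mult mult.assoc summable_mult del: of_real_diff)
  qed (auto simp: F_eq)
  then have AE: "AE t in lborel. summable (\<lambda>j. norm (F j t))"
    by simp
  have sum_int: "summable (\<lambda>j. LINT t|lborel. norm (F j t))"
  proof (rule summable_comparison_test')
    show "summable (\<lambda>j. norm (coeff \<delta> j) * u powr Re (s j) * (u powr (Re \<delta> + Re \<nu> - 1) * Beta (Re \<delta>) (Re \<nu>)))"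
      using summable_coeffs[OF u, of \<delta>] by (intro summable_mult2) (simp add: coeff_def)
    fix j :: nat
    \<comment> \<open>Beta decreases in its first argument, so its value at
      \<open>Re \<delta>\<close> bounds all Beta factors at once and only the coefficient series at
      T = u remains.\<close>
    have "Beta (Re (s j + \<delta>)) (Re \<nu>) \<le> Beta (Re \<delta>) (Re \<nu>)"
      using assms Re_exponent_nonneg[of j] by (intro Beta_real_mono) auto
    then have "norm (coeff \<delta> j) * (u powr (Re (s j + \<delta>) + Re \<nu> - 1) * Beta (Re (s j + \<delta>)) (Re \<nu>)) \<le>
               norm (coeff \<delta> j) * (u powr (Re (s j + \<delta>) + Re \<nu> - 1) * Beta (Re \<delta>) (Re \<nu>))"
      by (intro mult_left_mono) auto
    moreover have "u powr (Re (s j + \<delta>) + Re \<nu> - 1) = u powr Re (s j) * u powr (Re \<delta> + Re \<nu> - 1)"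
      by (simp add: powr_add[symmetric] algebra_simps)
    ultimately have "(LINT t|lborel. norm (F j t)) \<le>
          norm (coeff \<delta> j) * u powr Re (s j) * (u powr (Re \<delta> + Re \<nu> - 1) * Beta (Re \<delta>) (Re \<nu>))"
      unfolding has_bochner_integral_integral_eq[OF F_norm] by (simp only: mult.assoc)
    then show "norm (LINT t|lborel. norm (F j t)) \<le>
          norm (coeff \<delta> j) * u powr Re (s j) * (u powr (Re \<delta> + Re \<nu> - 1) * Beta (Re \<delta>) (Re \<nu>))"
      by simp
  qed
  have sum_F: "(\<Sum>j. F j t) = indicator {a<..<y} t *\<^sub>R (complex_of_real (y - t) powr (\<nu> - 1) * g t)" for t
  proof (cases "a < t \<and> t < y")
    case True
    have "summable (\<lambda>j. coeff \<delta> j * complex_of_real (t - a) powr (s j + (\<delta> - 1)))"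
      using True by (intro summable_norm_cancel[OF summable_norm_term]) simp
    then show ?thesis
      using True g[of t] unfolding F_eq
      by (simp add: series_fun_def suminf_mult add_diff_eq del: of_real_diff)
  qed (auto simp: F_eq)
  have "(LINT t|lborel. (\<Sum>j. F j t)) = (\<Sum>j. integral\<^sup>L lborel (F j))"
    by (rule integral_suminf[OF int AE sum_int])
  also have "\<dots> = (\<Sum>j. Gamma \<nu> * (coeff (\<delta> + \<nu>) j * u powr (s j + (\<delta> + \<nu>) - 1)))"
    using F_has by (simp add: has_bochner_integral_iff)
  also have "\<dots> = Gamma \<nu> * series_fun (\<delta> + \<nu>) u"
    unfolding series_fun_def
    using summable_norm_cancel[OF summable_norm_term[OF u, of "\<delta> + \<nu>" "\<delta> + \<nu> - 1"]]
    by (subst suminf_mult) (simp_all add: add_diff_eq)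
  finally show ?thesis
    using integrable_suminf[OF int AE sum_int] Gamma_complex_nonzero[OF assms(2)]
    by (simp add: RL_integrable_def RL_integral_def set_integrable_def set_lebesgue_integral_def sum_F u_def)
qed

section \<open>Termwise differentiation\<close>

lemma series_fun_has_vector_derivative:
  assumes "x > 0"
  shows "(series_fun \<delta> has_vector_derivative series_fun (\<delta> - 1) x) (at x)"
proof -
  \<comment> \<open>A neighbourhood of \<open>x\<close> bounded and bounded away from 0, on which
    powers with exponents of either sign are bounded.\<close>
  define S where "S = {x / 2<..<2 * x}"
  define f where "f = (\<lambda>j t. coeff \<delta> j * complex_of_real t powr (s j + \<delta> - 1))"
  define f' where "f' = (\<lambda>j t. coeff (\<delta> - 1) j * complex_of_real t powr (s j + (\<delta> - 1) - 1))"
  have S: "open S" "convex S" "x \<in> S" "\<And>t. t \<in> S \<Longrightarrow> t > 0"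
    using assms by (auto simp: S_def)
  have deriv_term: "(f j has_vector_derivative f' j t) (at t)" if "t \<in> S" for j t
  proof -
    \<comment> \<open>The recurrence also holds where s_j + \<delta> - 1 is a pole of Gamma: both
      sides are then 0, so no exponent needs separate treatment.\<close>
    have "(s j + \<delta> - 1) * rGamma (s j + \<delta>) = rGamma (s j + (\<delta> - 1))"
      using rGamma_plus1[of "s j + \<delta> - 1"] by (simp add: add_diff_eq)
    then have "coeff \<delta> j * (s j + \<delta> - 1) = coeff (\<delta> - 1) j"
      by (simp add: coeff_def mult_ac)
    moreover have "(f j has_vector_derivative
        coeff \<delta> j * ((s j + \<delta> - 1) * complex_of_real t powr (s j + \<delta> - 1 - 1))) (at t)"
      unfolding f_def using S(4)[OF that]
      by (intro has_vector_derivative_real_field) (auto intro!: derivative_eq_intros)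
    ultimately show ?thesis
      by (simp add: f'_def add_diff_eq mult.assoc[symmetric])
  qed
  \<comment> \<open>The sum of the two endpoint values dominates t powr Re (\<delta> - 2) on
    \<open>S\<close> whether this power increases or decreases.\<close>
  define M where "M = (x / 2) powr Re (\<delta> - 1 - 1) + (2 * x) powr Re (\<delta> - 1 - 1)"
  have "uniform_limit S (\<lambda>n t. \<Sum>j<n. f' j t) (\<lambda>t. \<Sum>j. f' j t) sequentially"
  proof (rule Weierstrass_m_test)
    show "summable (\<lambda>j. norm (coeff (\<delta> - 1) j) * (2 * x) powr Re (s j) * M)"
      using summable_coeffs[of "2 * x" "\<delta> - 1"] assms
      by (intro summable_mult2) (simp add: coeff_def)
    fix j t assume t: "t \<in> S"
    then have "t powr Re (\<delta> - 1 - 1) \<le> M"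
    proof (cases "Re (\<delta> - 1 - 1) \<ge> 0")
      case True
      then have "t powr Re (\<delta> - 1 - 1) \<le> (2 * x) powr Re (\<delta> - 1 - 1)"
        using t assms by (intro powr_mono2) (auto simp: S_def)
      then show ?thesis unfolding M_def by (rule order.trans) simp
    next
      case False
      then have "t powr Re (\<delta> - 1 - 1) \<le> (x / 2) powr Re (\<delta> - 1 - 1)"
        using t assms by (intro powr_mono2') (auto simp: S_def)
      then show ?thesis unfolding M_def by (rule order.trans) simp
    qed
    moreover have "t powr Re (s j) \<le> (2 * x) powr Re (s j)"
      using t assms Re_exponent_nonneg by (intro powr_mono2) (auto simp: S_def)
    moreover have "norm (f' j t) = norm (coeff (\<delta> - 1) j) * t powr Re (s j) * t powr Re (\<delta> - 1 - 1)"
      using norm_term[OF S(4)[OF t], of "\<delta> - 1" j "\<delta> - 1 - 1"] by (simp add: f'_def add_diff_eq)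
    ultimately show "norm (f' j t) \<le> norm (coeff (\<delta> - 1) j) * (2 * x) powr Re (s j) * M"
      by (auto intro!: mult_mono)
  qed
  then have lim: "uniform_limit S (\<lambda>n t. \<Sum>j<n. f' j t) (series_fun (\<delta> - 1)) sequentially"
    by (simp add: series_fun_def[abs_def] f'_def)
  have sums: "(\<lambda>j. f j t) sums series_fun \<delta> t" if "t \<in> S" for t
    using summable_norm_cancel[OF summable_norm_term[OF S(4)[OF that], of \<delta> "\<delta> - 1"]]
    by (simp add: series_fun_def f_def add_diff_eq summable_sums)
  have "\<exists>g. \<forall>t\<in>S. (\<lambda>j. f j t) sums g t \<and>
          (g has_derivative (\<lambda>h. h *\<^sub>R series_fun (\<delta> - 1) t)) (at t within S)"
  proof (rule has_derivative_series[where f = f and x = x])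
    show "convex S" "x \<in> S" "(\<lambda>j. f j x) sums series_fun \<delta> x"
      using S sums[OF S(3)] by simp_all
    show "(f j has_derivative (\<lambda>h. h *\<^sub>R f' j t)) (at t within S)" if "t \<in> S" for j t
      using deriv_term[OF that] by (auto simp: has_vector_derivative_def intro: has_derivative_at_withinI)
    fix e :: real assume "e > 0"
    then have "\<forall>\<^sub>F n in sequentially. \<forall>t\<in>S. dist (\<Sum>j<n. f' j t) (series_fun (\<delta> - 1) t) < e"
      using lim by (simp add: uniform_limit_iff)
    then show "\<forall>\<^sub>F n in sequentially. \<forall>t\<in>S. \<forall>h. norm ((\<Sum>j<n. h *\<^sub>R f' j t) - h *\<^sub>R series_fun (\<delta> - 1) t) \<le> e * norm h"
    proof eventually_elim
      case (elim n)
      show ?case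
      proof (intro ballI allI)
        fix t h assume "t \<in> S"
        have "norm ((\<Sum>j<n. h *\<^sub>R f' j t) - h *\<^sub>R series_fun (\<delta> - 1) t) =
                \<bar>h\<bar> * norm ((\<Sum>j<n. f' j t) - series_fun (\<delta> - 1) t)"
          by (simp add: scaleR_sum_right[symmetric] scaleR_diff_right[symmetric])
        also have "\<dots> \<le> \<bar>h\<bar> * e"
          using elim \<open>t \<in> S\<close> by (intro mult_left_mono) (auto simp: dist_norm less_imp_le)
        finally show "norm ((\<Sum>j<n. h *\<^sub>R f' j t) - h *\<^sub>R series_fun (\<delta> - 1) t) \<le> e * norm h"
          by (simp add: mult.commute)
      qed
    qed
  qed
  then obtain g where g: "\<And>t. t \<in> S \<Longrightarrow> (\<lambda>j. f j t) sums g t"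
      "(g has_derivative (\<lambda>h. h *\<^sub>R series_fun (\<delta> - 1) x)) (at x within S)"
    using S(3) by blast
  \<comment> \<open>The theorem on differentiating series only provides some limit function;
    uniqueness of sums identifies it.\<close>
  have "g t = series_fun \<delta> t" if "t \<in> S" for t
    using g(1)[OF that] sums[OF that] by (rule sums_unique2)
  then have "(series_fun \<delta> has_derivative (\<lambda>h. h *\<^sub>R series_fun (\<delta> - 1) x)) (at x within S)"
    by (intro has_derivative_transform[OF S(3) _ g(2)]) simp
  then show ?thesis
    by (simp only: has_vector_derivative_def at_within_open[OF S(3,1)])
qed

text \<open>Differentiation is local, so agreement with the series on the open half-line above
  \<open>a\<close> suffices. The induction covers all of that half-line, since each derivative needs
  the previous one in a neighbourhood.\<close>

lemma nth_derivative_series_fun: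
  assumes "\<And>t. t > a \<Longrightarrow> g t = series_fun \<delta> (t - a)" "t > a"
  shows "nth_derivative m g t = series_fun (\<delta> - of_nat m) (t - a) \<and>
         nth_derivative m g differentiable (at t)"
proof -
  have deriv: "(h has_vector_derivative series_fun (\<epsilon> - 1) (r - a)) (at r)"
    if "\<And>r. r > a \<Longrightarrow> h r = series_fun \<epsilon> (r - a)" "r > a" for h \<epsilon> r
  proof (rule has_vector_derivative_transform_within_open[where S = "{a<..}"])
    have "((series_fun \<epsilon> \<circ> (\<lambda>r. r - a)) has_vector_derivative 1 *\<^sub>R series_fun (\<epsilon> - 1) (r - a)) (at r)"
      using series_fun_has_vector_derivative[of "r - a" \<epsilon>] that(2)
      by (intro vector_diff_chain_at) (auto intro!: derivative_eq_intros)
    then show "((\<lambda>r. series_fun \<epsilon> (r - a)) has_vector_derivative series_fun (\<epsilon> - 1) (r - a)) (at r)"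
      by (simp add: o_def)
  qed (use that in auto)
  have eq: "nth_derivative m g r = series_fun (\<delta> - of_nat m) (r - a)" if "r > a" for r m
    using that
  proof (induction m arbitrary: r)
    case 0
    then show ?case
      using assms(1) by (simp add: nth_derivative_def)
  next
    case (Suc m)
    have "nth_derivative (Suc m) g r = vector_derivative (nth_derivative m g) (at r)"
      by (simp add: nth_derivative_def)
    also have "\<dots> = series_fun (\<delta> - of_nat m - 1) (r - a)"
      using deriv[OF Suc.IH Suc.prems] by (rule vector_derivative_at)
    finally show ?case
      by (simp add: algebra_simps)
  qed
  show ?thesis
    using eq[OF assms(2)] deriv[OF eq assms(2), of m]
    by (auto intro: differentiableI_vector)
qed

text \<open>With n the order, the integral of order n - \<nu> raises \<delta> to \<delta> + n -
  \<nu>, and n derivatives lower it to \<delta> - \<nu>.\<close>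

lemma RL_derivative_series_fun:
  assumes "Re \<delta> > 0" "Re \<nu> > 0" "y > a" and g: "\<And>r. r > a \<Longrightarrow> g r = series_fun \<delta> (r - a)"
  shows "RL_differentiable a \<nu> g \<and> RL_derivative a \<nu> g y = series_fun (\<delta> - \<nu>) (y - a)"
proof -
  define n where "n = RL_order \<nu>"
  \<comment> \<open>The inequality is strict even for integral \<open>Re \<nu>\<close>, because the
    order is the floor plus 1; the fractional integral therefore has order with positive real
    part.\<close>
  have "real n > Re \<nu>"
    using assms(2) unfolding n_def RL_order_def by linarith
  then have "Re (of_nat n - \<nu>) > 0"
    by simp
  note I = RL_integral_series_fun[OF assms(1) this _ g]
  have I': "RL_integral a (of_nat n - \<nu>) g t = series_fun (\<delta> + (of_nat n - \<nu>)) (t - a)" if "t > a" for t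
    using I[OF that] by simp
  have "RL_derivative a \<nu> g y = series_fun (\<delta> + (of_nat n - \<nu>) - of_nat n) (y - a)"
    using nth_derivative_series_fun[OF I' assms(3), of n] by (simp add: RL_derivative_def n_def)
  moreover have "RL_differentiable a \<nu> g"
    using I nth_derivative_series_fun[OF I'] by (auto simp: RL_differentiable_def n_def)
  ultimately show ?thesis
    by simp
qed

end

subsection \<open>The trivariate Mittag-Leffler function\<close>

text \<open>Absolute convergence turns the nested series into one series along any enumeration
  \<open>e\<close>. The powers of x inside the three variables and the prefactor then merge into a
  single power.\<close>

lemma powr_ml3_eq_suminf:
  fixes \<alpha> \<beta> \<gamma> \<delta> \<eta> l1 l2 l3 :: complex and x :: real
  assumes "Re \<alpha> > 0" "Re \<beta> > 0" "Re \<gamma> > 0" "x > 0" and e: "bij_betw e UNIV UNIV"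
  shows "complex_of_real x powr (\<delta> - 1) * mittag_leffler3 \<alpha> \<beta> \<gamma> \<delta> \<eta>
           (l1 * complex_of_real x powr \<alpha>) (l2 * complex_of_real x powr \<beta>) (l3 * complex_of_real x powr \<gamma>) =
         (\<Sum>n. ml3_coeff \<eta> (e n) * monomial3 l1 l2 l3 (e n) * rGamma (ml3_exponent \<alpha> \<beta> \<gamma> (e n) + \<delta>) *
               complex_of_real x powr (ml3_exponent \<alpha> \<beta> \<gamma> (e n) + \<delta> - 1))"
proof -
  let ?u = "l1 * complex_of_real x powr \<alpha>" and ?v = "l2 * complex_of_real x powr \<beta>"
    and ?w = "l3 * complex_of_real x powr \<gamma>"
  define f where "f = (\<lambda>j. ml3_coeff \<eta> j * rGamma (ml3_exponent \<alpha> \<beta> \<gamma> j + \<delta>) * monomial3 ?u ?v ?w j)"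
  have "(\<lambda>j. norm (f j)) summable_on UNIV"
  proof -
    have "norm (f j) = norm (ml3_coeff \<eta> j * rGamma (ml3_exponent \<alpha> \<beta> \<gamma> j + \<delta>)) *
            monomial3 (norm ?u) (norm ?v) (norm ?w) j" for j
      by (cases j) (simp add: f_def monomial3_def norm_mult norm_power)
    then show ?thesis
      using ml3_abs_summable[OF assms(1-3), of "norm ?u" "norm ?v" "norm ?w" \<eta> \<delta>] by simp
  qed
  then have f: "f summable_on UNIV"
    by (rule abs_summable_summable)
  have eq: "complex_of_real x powr (\<delta> - 1) * f j =
     ml3_coeff \<eta> j * monomial3 l1 l2 l3 j * rGamma (ml3_exponent \<alpha> \<beta> \<gamma> j + \<delta>) *
               complex_of_real x powr (ml3_exponent \<alpha> \<beta> \<gamma> j + \<delta> - 1)" for j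
  proof (cases j)
    case (fields l p k)
    have "complex_of_real x powr (of_nat n * \<zeta>) = (complex_of_real x powr \<zeta>) ^ n" for n \<zeta>
      using assms(4) by (simp add: powr_def exp_of_nat_mult[symmetric] mult.assoc)
    then have "complex_of_real x powr (ml3_exponent \<alpha> \<beta> \<gamma> j + (\<delta> - 1)) =
      (complex_of_real x powr \<alpha>) ^ l * (complex_of_real x powr \<beta>) ^ p * (complex_of_real x powr \<gamma>) ^ k *
        complex_of_real x powr (\<delta> - 1)"
      using assms(4) by (simp add: ml3_exponent_def fields powr_add)
    then show ?thesis
      by (simp add: f_def monomial3_def fields power_mult_distrib add_diff_eq mult_ac)
  qed
  have fe: "(\<lambda>n. f (e n)) summable_on UNIV"
    using f summable_on_reindex_bij_betw[OF e, of f] by simp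
  have "mittag_leffler3 \<alpha> \<beta> \<gamma> \<delta> \<eta> ?u ?v ?w = (\<Sum>l. \<Sum>p. \<Sum>k. f (l, p, k))"
    unfolding mittag_leffler3_def f_def ml3_coeff_def ml3_exponent_def monomial3_def by simp
  also have "\<dots> = infsum f UNIV"
    by (rule suminf_suminf_suminf_eq_infsum[OF f])
  also have "\<dots> = infsum (\<lambda>n. f (e n)) UNIV"
    using infsum_reindex_bij_betw[OF e, of f] by simp
  also have "\<dots> = (\<Sum>n. f (e n))"
    by (rule suminf_eq_infsum[OF fe, symmetric])
  finally show ?thesis
    using summable_on_imp_summable[OF fe]
    by (simp add: suminf_mult[symmetric] eq)
qed

text \<open>The factor T powr Re (s_j) splits into l-th, p-th and k-th powers, so the locale's
  condition is \<open>ml3_abs_summable\<close> at the variables |l1| T powr Re \<alpha>, |l2| T powr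
  Re \<beta>, |l3| T powr Re \<gamma>.\<close>

lemma fractional_power_series_ml3:
  fixes \<alpha> \<beta> \<gamma> \<delta> \<eta> l1 l2 l3 :: complex
  assumes "Re \<alpha> > 0" "Re \<beta> > 0" "Re \<gamma> > 0" and e: "bij_betw e UNIV UNIV"
  shows "fractional_power_series (\<lambda>n. ml3_coeff \<eta> (e n) * monomial3 l1 l2 l3 (e n))
           (\<lambda>n. ml3_exponent \<alpha> \<beta> \<gamma> (e n))"
proof
  fix n
  show "Re (ml3_exponent \<alpha> \<beta> \<gamma> (e n)) \<ge> 0"
    using assms by (simp add: ml3_exponent_def case_prod_unfold)
next
  fix \<delta> and T :: real assume T: "T > 0"
  define f where "f = (\<lambda>j. norm (ml3_coeff \<eta> j * rGamma (ml3_exponent \<alpha> \<beta> \<gamma> j + \<delta>)) *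
     monomial3 (norm l1 * T powr Re \<alpha>) (norm l2 * T powr Re \<beta>) (norm l3 * T powr Re \<gamma>) j)"
  have "f summable_on UNIV"
    unfolding f_def by (rule ml3_abs_summable[OF assms(1-3)]) auto
  then have "(\<lambda>n. f (e n)) summable_on UNIV"
    using summable_on_reindex_bij_betw[OF e, of f] by simp
  then have "summable (\<lambda>n. f (e n))"
    by (rule summable_on_imp_summable)
  moreover have "f j = norm (ml3_coeff \<eta> j * monomial3 l1 l2 l3 j * rGamma (ml3_exponent \<alpha> \<beta> \<gamma> j + \<delta>)) *
           T powr Re (ml3_exponent \<alpha> \<beta> \<gamma> j)" for j
  proof (cases j)
    case (fields l p k)
    have "T powr Re (ml3_exponent \<alpha> \<beta> \<gamma> j) = (T powr Re \<alpha>) ^ l * (T powr Re \<beta>) ^ p * (T powr Re \<gamma>) ^ k"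
      using T by (simp add: ml3_exponent_def fields powr_add powr_realpow[symmetric] powr_powr mult.commute)
    then show ?thesis
      by (simp add: f_def monomial3_def fields norm_mult norm_power power_mult_distrib mult_ac)
  qed
  ultimately show "summable (\<lambda>n. norm (ml3_coeff \<eta> (e n) * monomial3 l1 l2 l3 (e n) *
      rGamma (ml3_exponent \<alpha> \<beta> \<gamma> (e n) + \<delta>)) * T powr Re (ml3_exponent \<alpha> \<beta> \<gamma> (e n)))"
    by simp
qed

theorem theorem3p2:
  fixes a y :: real and \<nu> \<alpha> \<beta> \<gamma> \<delta> \<eta> l1 l2 l3 :: complex
  assumes "a \<ge> 0"
    and "Re \<nu> > 0" and "Re \<alpha> > 0" and "Re \<beta> > 0" and "Re \<gamma> > 0" and "Re \<delta> > 0"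
    and "y > a"
  shows "(RL_integrable a \<nu> (ml3_kernel a \<alpha> \<beta> \<gamma> \<delta> \<eta> l1 l2 l3) y \<and>
     RL_integral a \<nu> (ml3_kernel a \<alpha> \<beta> \<gamma> \<delta> \<eta> l1 l2 l3) y =
       complex_of_real (y - a) powr (\<delta> + \<nu> - 1) *
       mittag_leffler3 \<alpha> \<beta> \<gamma> (\<delta> + \<nu>) \<eta>
         (l1 * complex_of_real (y - a) powr \<alpha>)
         (l2 * complex_of_real (y - a) powr \<beta>)
         (l3 * complex_of_real (y - a) powr \<gamma>)) \<and>
    (RL_differentiable a \<nu> (ml3_kernel a \<alpha> \<beta> \<gamma> \<delta> \<eta> l1 l2 l3) \<and>
     RL_derivative a \<nu> (ml3_kernel a \<alpha> \<beta> \<gamma> \<delta> \<eta> l1 l2 l3) y =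
       complex_of_real (y - a) powr (\<delta> - \<nu> - 1) *
       mittag_leffler3 \<alpha> \<beta> \<gamma> (\<delta> - \<nu>) \<eta>
         (l1 * complex_of_real (y - a) powr \<alpha>)
         (l2 * complex_of_real (y - a) powr \<beta>)
         (l3 * complex_of_real (y - a) powr \<gamma>))"
proof -
  define e :: "nat \<Rightarrow> nat \<times> nat \<times> nat" where "e = from_nat_into UNIV"
  have e: "bij_betw e UNIV UNIV"
    unfolding e_def by (rule bij_betw_from_nat_into) (simp_all add: finite_prod)
  interpret fractional_power_series "\<lambda>n. ml3_coeff \<eta> (e n) * monomial3 l1 l2 l3 (e n)"
    "\<lambda>n. ml3_exponent \<alpha> \<beta> \<gamma> (e n)"
    by (rule fractional_power_series_ml3[OF assms(3-5) e])
  \<comment> \<open>Stated for an arbitrary parameter, since it is needed at \<delta> for the kernel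
    and at \<delta> + \<nu> and \<delta> - \<nu> for the two right-hand sides.\<close>
  have series: "complex_of_real x powr (\<epsilon> - 1) * mittag_leffler3 \<alpha> \<beta> \<gamma> \<epsilon> \<eta>
      (l1 * complex_of_real x powr \<alpha>) (l2 * complex_of_real x powr \<beta>) (l3 * complex_of_real x powr \<gamma>) =
      series_fun \<epsilon> x" if "x > 0" for x \<epsilon>
    unfolding powr_ml3_eq_suminf[OF assms(3-5) that e] series_fun_def coeff_def ..
  have kernel: "ml3_kernel a \<alpha> \<beta> \<gamma> \<delta> \<eta> l1 l2 l3 r = series_fun \<delta> (r - a)" if "r > a" for r
    unfolding ml3_kernel_def using that by (intro series) simp
  have "y - a > 0"
    using assms by simp
  then show ?thesis
    unfolding series[OF \<open>y - a > 0\<close>]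
    using RL_integral_series_fun[OF assms(6,2,7) kernel] RL_derivative_series_fun[OF assms(6,2,7) kernel]
    by blast
qed

end
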